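(* Let $(\mu_k)_{k\in\mathbb{Z}}$ be a bi-sequence in $M^1(\mathbb{R}^d)$ and let $\phi$ be a linear map on $\mathbb{R}^d$. Assume that $(\lambda_k)_{k\in\mathbb{Z}}$ is a bi-sequence in $M^1(\mathbb{R}^d)$ with $\lambda_k=\mu_k*\phi(\lambda_{k-1})$ for all $k\in\mathbb{Z}$. If $$\inf_{k}\ \prod_{i=-k}^{k}\lambda_i(\{x_i\})\neq 0$$ for some sequence $(x_k)_{k\in\mathbb{Z}}$ in $\mathbb{R}^d$, then $\mu_k$ is a Dirac measure for every $k\in\mathbb{Z}$.
   Context: $M^1(\mathbb{R}^d)$ is the space of Borel probability measures on $\mathbb{R}^d$; $*$ is convolution, and $\phi(\nu)$ is the image (push-forward) of $\nu$ under $\phi$. The infimum is over the integers $k\ge 0$.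
   Formalization: The linear map φ is assumed injective (invertible); for every singular φ the claim fails: take φ(v)=0, v≠0, λ_0=μ_0=(δ_0+δ_v)/2, all other λ_k=μ_k=δ_0, x_k=0, so all products equal 1/2 but μ_0 is not Dirac. *)

theory Defs
  imports "HOL-Probability.Probability"
begin

definition borel_prob_measures :: "'a::topological_space measure set" where
  "borel_prob_measures = {M. prob_space M \<and> sets M = sets borel}"

lemma convolution_return_zero:
  fixes M :: "'a::ordered_euclidean_space measure"
  assumes "M \<in> borel_prob_measures"
  shows "(M \<star> return borel 0) = M"
proof -
  interpret M: prob_space M using assms by (simp add: borel_prob_measures_def)
  have [measurable_cong]: "sets M = sets borel"
    using assms by (simp add: borel_prob_measures_def)
  interpret R: prob_space "return borel (0::'a)" by (rule prob_space_return) simp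
  show ?thesis
  proof (rule measure_eqI)
    fix A assume "A \<in> sets (M \<star> return borel 0)"
    then have A[measurable]: "A \<in> sets borel" by simp
    have "emeasure (M \<star> return borel 0) A = (\<integral>\<^sup>+x. \<integral>\<^sup>+y. indicator A (x + y) \<partial>return borel 0 \<partial>M)"
      by (rule convolution_emeasure')
         (auto simp: M.finite_measure_axioms R.finite_measure_axioms \<open>sets M = sets borel\<close>)
    also have "\<dots> = (\<integral>\<^sup>+x. indicator A x \<partial>M)"
      by (intro nn_integral_cong) (subst nn_integral_return, auto)
    also have "\<dots> = emeasure M A" by (simp add: \<open>sets M = sets borel\<close>)
    finally show "emeasure (M \<star> return borel 0) A = emeasure M A" .
  qed (simp add: \<open>sets M = sets borel\<close>)
qed

text \<open>Injectivity of \<open>\<phi>\<close> cannot be dispensed with: for every singular \<open>\<phi>\<close> there are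
  non-Dirac examples, obtained by placing a two-point measure on a coset of the kernel at time 0
  and Dirac measures at all other times.\<close>

lemma singular_map_counterexample:
  fixes \<phi> :: "real ^ 'n \<Rightarrow> real ^ 'n"
  assumes "linear \<phi>" and "\<not> inj \<phi>"
  shows "\<exists>\<mu> L x. (\<forall>k::int. \<mu> k \<in> borel_prob_measures) \<and> (\<forall>k. L k \<in> borel_prob_measures)
    \<and> (\<forall>k. L k = (\<mu> k \<star> distr (L (k - 1)) borel \<phi>))
    \<and> (INF k::nat. \<Prod>i\<in>{- int k..int k}. measure (L i) {x i}) \<noteq> 0
    \<and> \<not> (\<forall>k. \<exists>a. \<mu> k = return borel a)"
proof -
  obtain v where v: "v \<noteq> 0" "\<phi> v = 0"
    using assms by (auto simp: linear_injective_0)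
  have \<phi>0: "\<phi> 0 = 0" using assms(1) by (rule linear_0)
  have \<phi>m[measurable]: "\<phi> \<in> borel \<rightarrow>\<^sub>M borel"
    using assms(1) by (intro borel_measurable_continuous_onI linear_continuous_on)
      (simp add: linear_conv_bounded_linear)
  define S where "S k = (if k = 0 then {0, v} else {0})" for k :: int
  define L where "L k = distr (measure_pmf (pmf_of_set (S k))) borel id" for k
  have S: "finite (S k)" "S k \<noteq> {}" for k by (auto simp: S_def)
  have L: "L k \<in> borel_prob_measures" for k
    by (auto simp: L_def borel_prob_measures_def intro!: measure_pmf.prob_space_distr)
  have \<phi>L: "distr (L k) borel \<phi> = return borel 0" for k
  proof -
    have "distr (L k) borel \<phi> = distr (measure_pmf (pmf_of_set (S k))) borel \<phi>"
      unfolding L_def by (subst distr_distr) (auto simp: comp_def)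
    also have "\<dots> = distr (measure_pmf (pmf_of_set (S k))) borel (\<lambda>_. 0)"
      by (intro distr_cong_AE) (auto simp: AE_measure_pmf_iff S, auto simp: S_def v \<phi>0 split: if_splits)
    also have "\<dots> = return borel 0"
      by (intro measure_pmf.distr_const) simp
    finally show ?thesis .
  qed
  have meas: "measure (L k) {y} = (if y \<in> S k then 1 / real (card (S k)) else 0)" for k y
    unfolding L_def
    by (subst measure_distr) (auto simp: measure_pmf_single S)
  have prod: "(\<Prod>i\<in>{- int k..int k}. measure (L i) {0}) = 1 / 2" for k
  proof -
    have "(\<Prod>i\<in>{- int k..int k}. measure (L i) {0})
        = measure (L 0) {0} * (\<Prod>i\<in>{- int k..int k} - {0}. measure (L i) {0})"
      by (rule prod.remove) auto
    also have "(\<Prod>i\<in>{- int k..int k} - {0}. measure (L i) {0}) = 1"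
      by (rule prod.neutral) (auto simp: meas S_def)
    also have "measure (L 0) {0} = 1 / 2"
      using v by (simp add: meas S_def)
    finally show ?thesis by simp
  qed
  have "L 0 \<noteq> return borel a" for a
  proof
    assume "L 0 = return borel a"
    then have "measure (L 0) {0} = measure (return borel a) {0}" by simp
    then show False using v by (cases "a = 0") (auto simp: meas S_def measure_return indicator_def)
  qed
  moreover have "L k = (L k \<star> distr (L (k - 1)) borel \<phi>)" for k
    by (simp add: \<phi>L convolution_return_zero[OF L])
  moreover have "(INF k::nat. \<Prod>i\<in>{- int k..int k}. measure (L i) {0}) \<noteq> 0"
    unfolding prod by simp
  ultimately show ?thesis
    using L by (intro exI[of _ L] exI[of _ "\<lambda>_. 0"]) auto
qed

end

theory Submission
  imports Defs
begin

text \<open>Neither convolution nor an injective push-forward can increase the supremum of the atoms of a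
  probability measure. Hence a bound on the atoms of \<open>\<mu> k\<close> passes to \<open>L k\<close>, \<open>L (k + 1)\<close>, \<open>\<dots>\<close>.
  Since the product does not vanish, \<open>L i\<close> has atoms arbitrarily close to 1 for large \<open>i\<close>; thus so does
  \<open>\<mu> k\<close>, and such a measure is Dirac.\<close>

text \<open>The mass at \<open>z\<close> is the \<open>M\<close>-average of the masses
  \<open>N {z - x}\<close>, and an average of numbers at most \<open>s\<close> is at most
  \<open>s\<close>. Only the second factor needs bounded atoms.\<close>

lemma convolution_atoms_le:
  fixes M N :: "'a::ordered_euclidean_space measure"
  assumes M: "M \<in> borel_prob_measures" and N: "N \<in> borel_prob_measures"
    and le: "\<And>y. measure N {y} \<le> s"
  shows "measure (M \<star> N) {z} \<le> s"
proof -
  interpret M: prob_space M using M by (simp add: borel_prob_measures_def)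
  interpret N: prob_space N using N by (simp add: borel_prob_measures_def)
  have [measurable_cong]: "sets M = sets borel" "sets N = sets borel"
    using M N by (simp_all add: borel_prob_measures_def)
  have s: "0 \<le> s" using le[of 0] measure_nonneg[of N "{0}"] by linarith
  have "emeasure (M \<star> N) {z} = (\<integral>\<^sup>+x. \<integral>\<^sup>+y. indicator {z} (x + y) \<partial>N \<partial>M)"
    by (rule convolution_emeasure')
       (auto simp: M.finite_measure_axioms N.finite_measure_axioms \<open>sets M = sets borel\<close> \<open>sets N = sets borel\<close>)
  also have "\<dots> = (\<integral>\<^sup>+x. emeasure N {z - x} \<partial>M)"
  proof (rule nn_integral_cong)
    fix x
    have "(\<integral>\<^sup>+y. indicator {z} (x + y) \<partial>N) = (\<integral>\<^sup>+y. indicator {z - x} y \<partial>N)"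
      by (rule nn_integral_cong) (auto simp: indicator_def algebra_simps)
    then show "(\<integral>\<^sup>+y. indicator {z} (x + y) \<partial>N) = emeasure N {z - x}"
      by (simp add: \<open>sets N = sets borel\<close>)
  qed
  also have "\<dots> \<le> (\<integral>\<^sup>+x. ennreal s \<partial>M)"
    by (intro nn_integral_mono) (simp add: N.emeasure_eq_measure le ennreal_leI)
  also have "\<dots> = ennreal s" by (simp add: M.emeasure_space_1)
  finally have "emeasure (M \<star> N) {z} \<le> ennreal s" .
  then show ?thesis
    using s by (simp add: measure_def enn2real_leI)
qed

text \<open>Each fibre of an injective map is empty or a single point, so atoms cannot
  merge.\<close>

lemma distr_inj_atoms_le:
  fixes N :: "'a::t1_space measure" and f :: "'a \<Rightarrow> 'b::t1_space"
  assumes sets: "sets N = sets borel" and f: "f \<in> borel \<rightarrow>\<^sub>M borel" and "inj f"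
    and le: "\<And>y. measure N {y} \<le> s"
  shows "measure (distr N borel f) {z} \<le> s"
proof -
  have f': "f \<in> N \<rightarrow>\<^sub>M borel" using f sets by (simp cong: measurable_cong_sets)
  have "measure (distr N borel f) {z} = measure N (f -` {z})"
    using f' sets_eq_imp_space_eq[OF sets] by (simp add: measure_distr)
  also have "\<dots> \<le> s"
  proof (cases "\<exists>y. f y = z")
    case True
    then obtain y where "f y = z" ..
    with \<open>inj f\<close> have "f -` {z} = {y}" by (auto dest: injD)
    then show ?thesis using le by simp
  next
    case False
    then have "f -` {z} = {}" by auto
    then show ?thesis using order_trans[OF measure_nonneg le] by simp
  qed
  finally show ?thesis .
qed

text \<open>Two distinct atoms heavier than 1/2 cannot coexist, so an atom above 1/2 must already
  carry the whole mass.\<close>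

lemma atoms_sup_1_imp_Dirac:
  fixes M :: "'a::t1_space measure"
  assumes M: "M \<in> borel_prob_measures"
    and large: "\<And>s. s < 1 \<Longrightarrow> \<exists>y. s < measure M {y}"
  shows "\<exists>a. M = return borel a"
proof -
  interpret prob_space M using M by (simp add: borel_prob_measures_def)
  have sets[simp]: "sets M = sets borel" using M by (simp add: borel_prob_measures_def)
  obtain a where a: "1 / 2 < prob {a}" using large[of "1 / 2"] by auto
  have one: "prob {a} = 1"
  proof (rule ccontr)
    assume "prob {a} \<noteq> 1"
    then have "prob {a} < 1" using prob_le_1[of "{a}"] by linarith
    \<comment> \<open>With \<open>prob {a}\<close> itself as threshold, \<open>y\<close> is strictly
      heavier than \<open>a\<close>, hence a different point, and the two masses add up to more than
      1.\<close>
    then obtain y where y: "prob {a} < prob {y}" using large by blast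
    then have "prob ({a} \<union> {y}) = prob {a} + prob {y}"
      by (intro finite_measure_Union) auto
    then show False using a y prob_le_1[of "{a} \<union> {y}"] by linarith
  qed
  then have AE: "AE x in M. x = a"
    using prob_eq_1[of "{a}"] by simp
  have "M = return M a" using AE by (rule AE_eq_constD)
  also have "\<dots> = return borel a" by (rule return_cong) simp
  finally show ?thesis ..
qed

text \<open>Widening the window by \<open>n\<close> beyond \<open>k\<close> adds \<open>n\<close>
  factors at most \<open>s\<close>, while all others are at most 1; so the products are dominated by
  a null sequence \<open>s ^ n\<close>.\<close>

lemma symmetric_prod_INF_eq_0:
  fixes f :: "int \<Rightarrow> real"
  assumes f01: "\<And>i. 0 \<le> f i" "\<And>i. f i \<le> 1"
    and "s < 1" and le: "\<And>i. k \<le> i \<Longrightarrow> f i \<le> s"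
  shows "(INF n::nat. \<Prod>i\<in>{- int n..int n}. f i) = 0"
proof -
  define P where "P n = (\<Prod>i\<in>{- int n..int n}. f i)" for n
  \<comment> \<open>For negative \<open>k\<close> this is 0; in both cases every index above
    \<open>int m\<close> is at least \<open>k\<close>.\<close>
  define m where "m = nat k"
  have s: "0 \<le> s" using f01(1)[of k] le[of k] by simp
  have P0: "0 \<le> P n" for n unfolding P_def by (simp add: f01 prod_nonneg)
  have bound: "P (m + n) \<le> s ^ n" for n
  proof -
    \<comment> \<open>Half-open, so that it has exactly \<open>n\<close> elements.\<close>
    let ?B = "{int m<..int (m + n)}"
    have "P (m + n) = prod f ?B * prod f ({- int (m + n)..int (m + n)} - ?B)"
      unfolding P_def by (subst prod.subset_diff[of ?B]) (auto simp: mult.commute)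
    also have "\<dots> \<le> prod f ?B"
      using f01 by (intro mult_left_le prod_le_1 prod_nonneg) auto
    also have "\<dots> \<le> (\<Prod>i\<in>?B. s)"
      using f01 le by (intro prod_mono) (auto simp: m_def split: if_splits)
    finally show ?thesis by simp
  qed
  have bdd: "bdd_below (range P)" using P0 by (auto intro: bdd_belowI[of _ 0])
  have "(INF n. P n) \<le> s ^ n" for n
    using cINF_lower[OF bdd, of "m + n"] bound[of n] by simp
  moreover have "(\<lambda>n. s ^ n) \<longlonglongrightarrow> 0" using s \<open>s < 1\<close> by (rule LIMSEQ_realpow_zero)
  ultimately have "(INF n. P n) \<le> 0" by (intro LIMSEQ_le_const) auto
  moreover have "0 \<le> (INF n. P n)" by (rule cINF_greatest) (auto simp: P0)
  ultimately show ?thesis unfolding P_def by simp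
qed

theorem proposition1p1:
  fixes \<mu> L :: "int \<Rightarrow> (real ^ 'n) measure"
    and \<phi> :: "real ^ 'n \<Rightarrow> real ^ 'n"
    and x :: "int \<Rightarrow> real ^ 'n"
  assumes "\<And>k. \<mu> k \<in> borel_prob_measures"
    and "linear \<phi>"
    and "inj \<phi>"
    and "\<And>k. L k \<in> borel_prob_measures"
    and "\<And>k. L k = (\<mu> k \<star> distr (L (k - 1)) borel \<phi>)"
    and "(INF k::nat. \<Prod>i\<in>{- int k..int k}. measure (L i) {x i}) \<noteq> 0"
  shows "\<forall>k. \<exists>a. \<mu> k = return borel a"
proof
  fix k
  have \<phi>: "\<phi> \<in> borel \<rightarrow>\<^sub>M borel"
    using assms(2) by (intro borel_measurable_continuous_onI linear_continuous_on)
      (simp add: linear_conv_bounded_linear)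
  have prob: "prob_space (\<mu> i)" "prob_space (L i)"
    and sets: "sets (\<mu> i) = sets borel" "sets (L i) = sets borel" for i
    using assms(1)[of i] assms(4)[of i] by (auto simp: borel_prob_measures_def)
  have \<phi>L: "distr (L i) borel \<phi> \<in> borel_prob_measures" for i
    using \<phi> prob(2)[of i] sets(2)[of i]
    by (auto simp: borel_prob_measures_def cong: measurable_cong_sets intro!: prob_space.prob_space_distr)
  show "\<exists>a. \<mu> k = return borel a"
  \<comment> \<open>The negated goal is a uniform bound \<open>s < 1\<close> on the atoms of
    \<open>\<mu> k\<close>.\<close>
  proof (rule atoms_sup_1_imp_Dirac[OF assms(1)], rule ccontr)
    fix s :: real
    assume "s < 1" and "\<nexists>y. s < measure (\<mu> k) {y}"
    then have \<mu>: "measure (\<mu> k) {y} \<le> s" for y by (simp add: not_less)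
    have L: "measure (L i) {y} \<le> s" if "k \<le> i" for i y
      using that
    proof (induction i arbitrary: y rule: int_ge_induct)
      case base
      \<comment> \<open>The factors are swapped to put \<open>\<mu> k\<close>, whose atoms are
        bounded, in second place.\<close>
      have "L k = (distr (L (k - 1)) borel \<phi> \<star> \<mu> k)"
        unfolding assms(5)[of k]
        using prob \<phi>L[of "k - 1"] sets
        by (intro convolution_commutative)
          (auto simp: borel_prob_measures_def intro: prob_space.finite_measure)
      then show ?case
        using convolution_atoms_le[OF \<phi>L assms(1) \<mu>] by simp
    next
      case (step i)
      \<comment> \<open>Now the bounded factor is the push-forward of \<open>L i\<close>, already in
        second place; injectivity of \<open>\<phi>\<close> carries the bound over to it.\<close>
      show ?case
        unfolding assms(5)[of "i + 1"]
        by (intro convolution_atoms_le assms(1) \<phi>L distr_inj_atoms_le \<phi> assms(3))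
          (simp_all add: sets step.IH)
    qed
    have "(INF n::nat. \<Prod>i\<in>{- int n..int n}. measure (L i) {x i}) = 0"
      by (rule symmetric_prod_INF_eq_0[OF _ _ \<open>s < 1\<close>, of _ k])
        (auto simp: L prob_space.prob_le_1[OF prob(2)])
    with assms(6) show False ..
  qed
qed

end
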